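(* Let $k\geq 1$ and $n\geq 2k$ be integers. Let $\mathcal{D}$ be the set of all $k$-partition diagrams (set partitions of $[k]\cup[k']$) having no blocks of size one. Then $\{\bar d \mid d\in\mathcal{D}\}$ is a basis of the complex vector space $QP_k(n)=\mathrm{End}_{S_n}(W^{\otimes k})$.
   Context: Let $[k]=\{1,\dots,k\}$ and $[k']=\{1',\dots,k'\}$ be disjoint sets. A $k$-partition diagram is a set partition $d$ of $[k]\cup[k']$, drawn as a graph with top row of vertices $1,\dots,k$ and bottom row $1',\dots,k'$, whose connected components are the blocks of $d$; an isolated vertex is a block of size one. Let $V$ be the permutation representation of $S_n$ over $\mathbb{C}$ with basis $v_1,\dots,v_n$. A diagram $d$ acts on $V^{\otimes k}$ by $$d\cdot(v_{i_{1'}}\otimes\cdots\otimes v_{i_{k'}})=\sum v_{i_1}\otimes\cdots\otimes v_{i_k},$$ where the sum is over all $(i_1,\dots,i_k)\in\{1,\dots,n\}^k$ such that $i_s=i_t$ whenever $s,t\in[k]\cup[k']$ lie in the same block of $d$ (so it is zero if this is impossible). Let $W\subset V$ be the irreducible $S_n$-submodule spanned by $w_j=v_j-v_1$, $2\leq j\leq n$ (isomorphic to the Specht module $S^{(n-1,1)}$). Let $\pi:V\to W$ be the projection $\pi(v_i)=v_i-\frac1n\sum_{j=1}^n v_j$, and let $\pi^{\otimes k}:V^{\otimes k}\to W^{\otimes k}$. The quasi-partition algebra is $QP_k(n)=\mathrm{End}_{S_n}(W^{\otimes k})$, with $S_n$ acting diagonally. For a diagram $d$, $\bar d$ denotes the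 operator $\pi^{\otimes k}\circ d$ restricted to $W^{\otimes k}$, an endomorphism of $W^{\otimes k}$. *)

theory Defs
  imports
    Complex_Main
    "HOL-Library.Function_Algebras"
    "HOL-Library.FuncSet"
    "HOL-Library.Disjoint_Sets"
    "HOL-Combinatorics.Permutations"
begin

type_synonym cvec = "nat \<Rightarrow> complex"

text \<open>
  A tensor of order k is given by its coordinates: it maps a multi-index
  \<open>i = (i 1, ..., i k)\<close> to the coefficient of \<open>v (i 1) \<otimes> ... \<otimes> v (i k)\<close>.
  Multi-indices are functions extensional on \<open>{1..k}\<close>, so that every tuple has exactly
  one representative; all coefficients at other functions vanish.
\<close>

type_synonym ctensor = "(nat \<Rightarrow> nat) \<Rightarrow> complex"

definition fun_scale :: "complex \<Rightarrow> ('a \<Rightarrow> complex) \<Rightarrow> ('a \<Rightarrow> complex)"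
  where "fun_scale c x = (\<lambda>i. c * x i)"

definition op_scale :: "complex \<Rightarrow> ('b \<Rightarrow> 'a \<Rightarrow> complex) \<Rightarrow> ('b \<Rightarrow> 'a \<Rightarrow> complex)"
  where "op_scale c F = (\<lambda>x. fun_scale c (F x))"

global_interpretation fun_vs: vector_space fun_scale
  by unfold_locales (auto simp: fun_scale_def fun_eq_iff algebra_simps)

global_interpretation op_vs: vector_space op_scale
  by unfold_locales (auto simp: op_scale_def fun_scale_def fun_eq_iff algebra_simps)

definition v :: "nat \<Rightarrow> cvec"
  where "v i = (\<lambda>j. if j = i then 1 else 0)"

definition W :: "nat \<Rightarrow> cvec set"
  where "W n = fun_vs.span {v j - v 1 | j. j \<in> {2..n}}"

definition proj :: "nat \<Rightarrow> cvec \<Rightarrow> cvec"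
  where "proj n x =
    (\<Sum>i\<in>{1..n}. fun_scale (x i) (v i - fun_scale (1 / of_nat n) (\<Sum>j\<in>{1..n}. v j)))"

definition perm_act :: "nat \<Rightarrow> (nat \<Rightarrow> nat) \<Rightarrow> cvec \<Rightarrow> cvec"
  where "perm_act n \<sigma> x = (\<Sum>i\<in>{1..n}. fun_scale (x i) (v (\<sigma> i)))"

definition multi_indices :: "nat \<Rightarrow> nat \<Rightarrow> (nat \<Rightarrow> nat) set"
  where "multi_indices n k = {1..k} \<rightarrow>\<^sub>E {1..n}"

text \<open>The simple tensor \<open>u 1 \<otimes> ... \<otimes> u k\<close>.\<close>

definition tensor :: "nat \<Rightarrow> (nat \<Rightarrow> cvec) \<Rightarrow> ctensor"
  where "tensor k u = (\<lambda>i. if i \<in> extensional {1..k} then (\<Prod>s\<in>{1..k}. u s (i s)) else 0)"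

text \<open>
  The k-th tensor power of a linear map f on V, i.e. the linear map on \<open>V\<^sup>\<otimes>\<^sup>k\<close> sending
  \<open>v (i 1) \<otimes> ... \<otimes> v (i k)\<close> to \<open>f (v (i 1)) \<otimes> ... \<otimes> f (v (i k))\<close>. Applied to
  \<open>perm_act n \<sigma>\<close> it is the diagonal action of \<open>\<sigma>\<close>.
\<close>

definition tensor_map :: "nat \<Rightarrow> nat \<Rightarrow> (cvec \<Rightarrow> cvec) \<Rightarrow> ctensor \<Rightarrow> ctensor"
  where "tensor_map n k f x =
    (\<Sum>i\<in>multi_indices n k. fun_scale (x i) (tensor k (\<lambda>s. f (v (i s)))))"

definition W_tensor :: "nat \<Rightarrow> nat \<Rightarrow> ctensor set"
  where "W_tensor n k = fun_vs.span {tensor k w | w. \<forall>s\<in>{1..k}. w s \<in> W n}"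

text \<open>
  \<open>Inl s\<close> is the top vertex s and \<open>Inr s\<close> the bottom vertex s'.
\<close>

type_synonym diagram = "(nat + nat) set set"

definition partition_diagrams :: "nat \<Rightarrow> diagram set"
  where "partition_diagrams k = {d. partition_on ({1..k} <+> {1..k}) d}"

definition diagrams_no_singletons :: "nat \<Rightarrow> diagram set"
  where "diagrams_no_singletons k = {d \<in> partition_diagrams k. \<forall>B\<in>d. card B \<noteq> 1}"

text \<open>Here i labels the top row and j the bottom row.\<close>

definition compatible :: "diagram \<Rightarrow> (nat \<Rightarrow> nat) \<Rightarrow> (nat \<Rightarrow> nat) \<Rightarrow> bool"
  where "compatible d i j \<longleftrightarrow> (\<forall>B\<in>d. \<forall>s\<in>B. \<forall>t\<in>B. case_sum i j s = case_sum i j t)"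

definition diagram_act :: "nat \<Rightarrow> nat \<Rightarrow> diagram \<Rightarrow> ctensor \<Rightarrow> ctensor"
  where "diagram_act n k d x =
    (\<Sum>j\<in>multi_indices n k. fun_scale (x j)
      (\<Sum>i | i \<in> multi_indices n k \<and> compatible d i j. tensor k (\<lambda>s. v (i s))))"

text \<open>
  HOL functions are total, so an endomorphism of \<open>W\<^sup>\<otimes>\<^sup>k\<close> is represented by its unique
  extension by 0 outside \<open>W\<^sup>\<otimes>\<^sup>k\<close>. This set is closed under the pointwise operations,
  which therefore give the usual vector space structure on the endomorphisms.
\<close>

definition quasi_partition_algebra :: "nat \<Rightarrow> nat \<Rightarrow> (ctensor \<Rightarrow> ctensor) set"
  where "quasi_partition_algebra n k = {F.
    (\<forall>x. x \<notin> W_tensor n k \<longrightarrow> F x = 0) \<and>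
    (\<forall>x\<in>W_tensor n k. F x \<in> W_tensor n k) \<and>
    (\<forall>x\<in>W_tensor n k. \<forall>y\<in>W_tensor n k. F (x + y) = F x + F y) \<and>
    (\<forall>c. \<forall>x\<in>W_tensor n k. F (fun_scale c x) = fun_scale c (F x)) \<and>
    (\<forall>\<sigma>. \<sigma> permutes {1..n} \<longrightarrow> (\<forall>x\<in>W_tensor n k.
      F (tensor_map n k (perm_act n \<sigma>) x) = tensor_map n k (perm_act n \<sigma>) (F x)))}"

definition bar :: "nat \<Rightarrow> nat \<Rightarrow> diagram \<Rightarrow> ctensor \<Rightarrow> ctensor"
  where "bar n k d =
    (\<lambda>x. if x \<in> W_tensor n k then tensor_map n k (proj n) (diagram_act n k d x) else 0)"

end

theory Submission imports Defs begin

text \<open>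
  Everything is expressed by matrices. A function \<open>f\<close> of labellings of the \<open>2k\<close> vertices has as
  values the entries of a matrix on \<open>V\<^sup>\<otimes>\<^sup>k\<close>, the labels of the top row being the row index and those of
  the bottom row the column index. Composing with \<open>\<pi>\<^sup>\<otimes>\<^sup>k\<close> gives a linear map \<open>kernel_op\<close> from such
  functions to operators on \<open>W\<^sup>\<otimes>\<^sup>k\<close>, and \<open>bar d\<close> is the image of the indicator function \<open>diagram_fn d\<close> of
  the labellings that are constant on the blocks of \<open>d\<close>.

  Spanning. An equivariant endomorphism \<open>F\<close> of \<open>W\<^sup>\<otimes>\<^sup>k\<close> is \<open>kernel_op\<close> of the matrix of \<open>F \<circ> \<pi>\<^sup>\<otimes>\<^sup>k\<close>
  (\<open>endomorphism_eq_kernel_op\<close>), which is constant on the orbits of the symmetric group. Two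
  labellings lie in one orbit exactly if the same pairs of vertices have equal labels, so the matrix is a
  combination of indicator functions of orbits, one for each diagram; and since \<open>diagram_fn d\<close> is
  the sum of the orbit indicators of the diagrams coarser than or equal to \<open>d\<close>, the \<open>diagram_fn d\<close> span the same
  space as the orbit indicators (\<open>orbit_fn_in_span\<close>). A diagram with an isolated vertex contributes nothing:
  at that vertex the entries do not depend on the label, while both \<open>\<pi>\<close> and the vectors of \<open>W\<close>
  have coordinate sum zero (\<open>bar_isolated\<close>).

  Independence. Choose a vector \<open>u s \<in> W\<close> for every vertex \<open>s\<close>, apply an operator to the tensor product of the bottom
  vectors and pair the result with that of the top vectors. This turns \<open>bar d'\<close> into the sum
  of \<open>\<Prod>s. u s (g s)\<close> over the labellings \<open>g\<close> that are constant on the blocks of \<open>d'\<close>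
  (\<open>kernel_op_pairing\<close>). For each \<open>d\<close> without isolated vertices there are test vectors for which this
  vanishes unless \<open>d'\<close> refines \<open>d\<close>, and is positive for \<open>d' = d\<close> (\<open>ex_test_vectors\<close>). They spend one
  basis vector of \<open>V\<close> on each vertex, which is where \<open>n \<ge> 2k\<close> enters. In a vanishing linear combination, the test
  vectors of a finest diagram that occurs give a contradiction.
\<close>

section \<open>Coordinates\<close>

lemma sum_apply: "(\<Sum>a\<in>A. f a) x = (\<Sum>a\<in>A. f a x)"
  by (induction A rule: infinite_finite_induct) auto

lemma finite_multi_indices [simp]: "finite (multi_indices n k)"
  unfolding multi_indices_def by (rule finite_PiE) auto

lemma multi_indices_extensional: "i \<in> multi_indices n k \<Longrightarrow> i \<in> extensional {1..k}"
  by (auto simp: multi_indices_def PiE_def)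

lemma multi_indices_range: "i \<in> multi_indices n k \<Longrightarrow> s \<in> {1..k} \<Longrightarrow> i s \<in> {1..n}"
  by (auto simp: multi_indices_def PiE_def)

lemma tensor_map_apply:
  "tensor_map n k f x i = (\<Sum>j\<in>multi_indices n k. x j * tensor k (\<lambda>s. f (v (j s))) i)"
  by (simp add: tensor_map_def sum_apply fun_scale_def)

lemma tensor_map_cong:
  "(\<And>i. i \<in> multi_indices n k \<Longrightarrow> x i = y i) \<Longrightarrow> tensor_map n k f x = tensor_map n k f y"
  unfolding tensor_map_def by (rule sum.cong) auto

lemma linear_tensor_map: "Vector_Spaces.linear fun_scale fun_scale (tensor_map n k f)"
  by unfold_locales
    (auto simp: fun_eq_iff tensor_map_apply fun_scale_def algebra_simps sum.distrib sum_distrib_left)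

lemma tensor_basis:
  assumes "j \<in> multi_indices n k"
  shows "tensor k (\<lambda>s. v (j s)) i = (if i = j then 1 else 0)"
proof (cases "i = j")
  case True
  then show ?thesis using multi_indices_extensional[OF assms] by (simp add: tensor_def v_def)
next
  case False
  show ?thesis
  proof (cases "i \<in> extensional {1..k}")
    case True
    with False multi_indices_extensional[OF assms] obtain s where "s \<in> {1..k}" "i s \<noteq> j s"
      by (meson extensionalityI)
    then have "(\<Prod>s\<in>{1..k}. v (j s) (i s)) = 0"
      by (intro prod_zero) (auto simp: v_def)
    then show ?thesis using False by (simp add: tensor_def)
  qed (use False in \<open>auto simp: tensor_def\<close>)
qed

lemma diagram_act_apply:
  "diagram_act n k d x i =
    (if i \<in> multi_indices n k
     then \<Sum>j\<in>multi_indices n k. of_bool (compatible d i j) * x j else 0)"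
proof -
  have fin: "finite {i. i \<in> multi_indices n k \<and> P i}" for P
    by simp
  have "(\<Sum>i' | i' \<in> multi_indices n k \<and> compatible d i' j. tensor k (\<lambda>s. v (i' s)) i) =
      of_bool (i \<in> multi_indices n k \<and> compatible d i j)" for j
  proof -
    have "(\<Sum>i' | i' \<in> multi_indices n k \<and> compatible d i' j. tensor k (\<lambda>s. v (i' s)) i) =
      (\<Sum>i' | i' \<in> multi_indices n k \<and> compatible d i' j. if i = i' then 1 else 0)"
      by (rule sum.cong) (auto simp: tensor_basis)
    then show ?thesis by (simp add: sum.delta'[OF fin])
  qed
  then show ?thesis
    by (auto simp: diagram_act_def sum_apply fun_scale_def intro!: sum.cong)
qed

lemma sum_v: "(\<Sum>j\<in>{1..n}. v j) x = (if x \<in> {1..n} then 1 else 0)"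
  by (simp add: sum_apply v_def)

lemma proj_apply:
  "proj n w x = (if x \<in> {1..n} then w x - (\<Sum>y\<in>{1..n}. w y) / of_nat n else 0)"
proof -
  have "proj n w x = (\<Sum>y\<in>{1..n}. fun_scale (w y)
      (v y - fun_scale (1 / of_nat n) (\<Sum>j\<in>{1..n}. v j)) x)"
    unfolding proj_def by (rule sum_apply)
  also have "\<dots> = (\<Sum>y\<in>{1..n}. w y * v y x) -
      (\<Sum>y\<in>{1..n}. w y * ((\<Sum>j\<in>{1..n}. v j) x / of_nat n))"
    by (simp add: fun_scale_def right_diff_distrib sum_subtractf)
  also have "(\<Sum>y\<in>{1..n}. w y * v y x) = (if x \<in> {1..n} then w x else 0)"
    by (simp add: v_def if_distrib cong: if_cong)
  finally show ?thesis
    unfolding sum_v by (simp add: sum_divide_distrib)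
qed

text \<open>The matrix entries of \<open>\<pi>\<close> and of \<open>\<pi>\<^sup>\<otimes>\<^sup>k\<close>.\<close>

definition proj_coeff :: "nat \<Rightarrow> nat \<Rightarrow> nat \<Rightarrow> complex"
  where "proj_coeff n x y = of_bool (x = y) - 1 / of_nat n"

definition proj_kernel :: "nat \<Rightarrow> nat \<Rightarrow> (nat \<Rightarrow> nat) \<Rightarrow> (nat \<Rightarrow> nat) \<Rightarrow> complex"
  where "proj_kernel n k i j = (\<Prod>s\<in>{1..k}. proj_coeff n (i s) (j s))"

lemma proj_v: "y \<in> {1..n} \<Longrightarrow> proj n (v y) x = (if x \<in> {1..n} then proj_coeff n x y else 0)"
  by (simp add: proj_apply proj_coeff_def v_def)

lemma tensor_outside:
  assumes "\<And>s x. s \<in> {1..k} \<Longrightarrow> x \<notin> {1..n} \<Longrightarrow> u s x = 0" and "i \<notin> multi_indices n k"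
  shows "tensor k u i = 0"
proof (cases "i \<in> extensional {1..k}")
  case True
  with assms(2) obtain s where "s \<in> {1..k}" "i s \<notin> {1..n}"
    unfolding multi_indices_def PiE_iff by blast
  then have "u s (i s) = 0" using assms(1) by blast
  then show ?thesis using \<open>s \<in> {1..k}\<close> by (auto simp: tensor_def intro!: prod_zero)
qed (simp add: tensor_def)

lemma tensor_proj_v:
  assumes "j \<in> multi_indices n k"
  shows "tensor k (\<lambda>s. proj n (v (j s))) i = (if i \<in> multi_indices n k then proj_kernel n k i j else 0)"
proof (cases "i \<in> multi_indices n k")
  case True
  then show ?thesis
    using multi_indices_range[OF True] multi_indices_range[OF assms] multi_indices_extensional[OF True]
    by (auto simp: tensor_def proj_kernel_def proj_v intro!: prod.cong)
next
  case False
  then show ?thesis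
    by (auto intro!: tensor_outside[of k n] simp: proj_apply)
qed

lemma tensor_map_proj_apply:
  "tensor_map n k (proj n) x i =
    (if i \<in> multi_indices n k then \<Sum>j\<in>multi_indices n k. proj_kernel n k i j * x j else 0)"
  by (auto simp: tensor_map_apply tensor_proj_v intro!: sum.cong)

lemma proj_kernel_sym: "proj_kernel n k i j = proj_kernel n k j i"
  unfolding proj_kernel_def proj_coeff_def by (intro prod.cong) auto

section \<open>The tensor power of the irreducible submodule\<close>

lemma v_diff_in_W:
  assumes "a \<in> {1..n}" "b \<in> {1..n}"
  shows "v a - v b \<in> W n"
proof -
  have *: "v c - v 1 \<in> W n" if "c \<in> {1..n}" for c
  proof (cases "c = 1")
    case True
    then show ?thesis using fun_vs.span_zero by (simp add: W_def)
  next
    case False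
    with that have "c \<in> {2..n}" by auto
    then show ?thesis unfolding W_def by (auto intro: fun_vs.span_base)
  qed
  have "(v a - v 1) - (v b - v 1) \<in> W n"
    using *[OF assms(1)] *[OF assms(2)] unfolding W_def by (rule fun_vs.span_diff)
  then show ?thesis by simp
qed

lemma proj_v_in_W:
  assumes "a \<in> {1..n}"
  shows "proj n (v a) \<in> W n"
proof -
  have "n > 0" using assms by auto
  have "proj n (v a) = (\<Sum>b\<in>{1..n}. fun_scale (1 / of_nat n) (v a - v b))"
  proof
    fix x
    have "(\<Sum>b\<in>{1..n}. fun_scale (1 / of_nat n) (v a - v b)) x =
        (\<Sum>b\<in>{1..n}. fun_scale (1 / of_nat n) (v a - v b) x)"
      by (rule sum_apply)
    also have "\<dots> = v a x - (\<Sum>b\<in>{1..n}. v b) x / of_nat n"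
      using \<open>n > 0\<close>
      by (simp add: sum_apply[of v] fun_scale_def sum_subtractf diff_divide_distrib sum_divide_distrib)
    also have "\<dots> = proj n (v a) x"
      using assms unfolding sum_v by (auto simp: proj_apply v_def)
    finally show "proj n (v a) x = (\<Sum>b\<in>{1..n}. fun_scale (1 / of_nat n) (v a - v b)) x" ..
  qed
  moreover have "(\<Sum>b\<in>{1..n}. fun_scale (1 / of_nat n) (v a - v b)) \<in> W n"
    using v_diff_in_W[OF assms] unfolding W_def
    by (intro fun_vs.span_sum fun_vs.span_scale) auto
  ultimately show ?thesis by simp
qed

lemma W_coordinates:
  assumes "w \<in> W n"
  shows "(\<forall>x. x \<notin> {1..n} \<longrightarrow> w x = 0) \<and> (\<Sum>x\<in>{1..n}. w x) = 0"
  using assms unfolding W_def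
proof (induction rule: fun_vs.span_induct_alt)
  case (step c w y)
  then obtain j where j: "j \<in> {2..n}" and w: "w = v j - v 1" by auto
  then have "(\<Sum>x\<in>{1..n}. w x) = 0"
    by (simp add: v_def sum_subtractf)
  moreover have "w x = 0" if "x \<notin> {1..n}" for x
    using j w that by (auto simp: v_def)
  ultimately show ?case
    using step by (simp add: fun_scale_def sum.distrib flip: sum_distrib_left)
qed auto

lemma proj_W: "w \<in> W n \<Longrightarrow> proj n w = w"
  using W_coordinates[of w n] by (auto simp: fun_eq_iff proj_apply)

lemma tensor_in_W_tensor: "(\<And>s. s \<in> {1..k} \<Longrightarrow> w s \<in> W n) \<Longrightarrow> tensor k w \<in> W_tensor n k"
  unfolding W_tensor_def by (rule fun_vs.span_base) auto

lemma subspace_W_tensor: "fun_vs.subspace (W_tensor n k)"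
  unfolding W_tensor_def by (rule fun_vs.subspace_span)

lemma tensor_map_proj_in_W_tensor: "tensor_map n k (proj n) x \<in> W_tensor n k"
  unfolding tensor_map_def
  by (intro fun_vs.subspace_sum[OF subspace_W_tensor] fun_vs.subspace_scale[OF subspace_W_tensor]
      tensor_in_W_tensor proj_v_in_W) (rule multi_indices_range)

lemma tensor_map_proj_tensor:
  "tensor_map n k (proj n) (tensor k w) = tensor k (\<lambda>s. proj n (w s))"
proof
  fix i
  show "tensor_map n k (proj n) (tensor k w) i = tensor k (\<lambda>s. proj n (w s)) i"
  proof (cases "i \<in> multi_indices n k")
    case True
    have "tensor_map n k (proj n) (tensor k w) i =
        (\<Sum>j\<in>multi_indices n k. \<Prod>s\<in>{1..k}. proj_coeff n (i s) (j s) * w s (j s))"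
      using True by (auto simp: tensor_map_proj_apply proj_kernel_def tensor_def
          prod.distrib dest: multi_indices_extensional intro!: sum.cong)
    also have "\<dots> = (\<Prod>s\<in>{1..k}. \<Sum>y\<in>{1..n}. proj_coeff n (i s) y * w s y)"
      unfolding multi_indices_def by (rule prod_sum_PiE[symmetric]) auto
    also have "\<dots> = (\<Prod>s\<in>{1..k}. proj n (w s) (i s))"
    proof (rule prod.cong)
      fix s assume "s \<in> {1..k}"
      then have "i s \<in> {1..n}" using True multi_indices_range by blast
      then show "(\<Sum>y\<in>{1..n}. proj_coeff n (i s) y * w s y) = proj n (w s) (i s)"
        by (simp add: proj_coeff_def proj_apply left_diff_distrib sum_subtractf sum_divide_distrib)
    qed simp
    finally show ?thesis using multi_indices_extensional[OF True] by (simp add: tensor_def)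
  next
    case False
    then have "tensor k (\<lambda>s. proj n (w s)) i = 0"
      by (intro tensor_outside[of k n]) (auto simp: proj_apply)
    then show ?thesis using False by (simp add: tensor_map_proj_apply)
  qed
qed

text \<open>
  Together with \<open>tensor_map_proj_in_W_tensor\<close> this makes \<open>\<pi>\<^sup>\<otimes>\<^sup>k\<close> a projection onto \<open>W\<^sup>\<otimes>\<^sup>k\<close>, so that the span
  defining \<open>W\<^sup>\<otimes>\<^sup>k\<close> can be replaced by a condition on coordinates.
\<close>

lemma tensor_map_proj_W_tensor:
  assumes "x \<in> W_tensor n k"
  shows "tensor_map n k (proj n) x = x"
proof -
  interpret L: Vector_Spaces.linear fun_scale fun_scale "tensor_map n k (proj n)"
    by (rule linear_tensor_map)
  show ?thesis
    using assms unfolding W_tensor_def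
  proof (induction rule: fun_vs.span_induct_alt)
    case (step c x y)
    then obtain w where "x = tensor k w" "\<forall>s\<in>{1..k}. w s \<in> W n" by auto
    then have "tensor k (\<lambda>s. proj n (w s)) = tensor k w"
      by (auto simp: tensor_def proj_W intro!: prod.cong)
    then have "tensor_map n k (proj n) x = x"
      using \<open>x = tensor k w\<close> by (simp add: tensor_map_proj_tensor)
    then show ?case unfolding L.add L.scale using step by simp
  qed (rule L.zero)
qed

section \<open>The diagonal action of the symmetric group\<close>

definition act_index :: "nat \<Rightarrow> (nat \<Rightarrow> nat) \<Rightarrow> (nat \<Rightarrow> nat) \<Rightarrow> (nat \<Rightarrow> nat)"
  where "act_index k \<sigma> i = (\<lambda>s\<in>{1..k}. \<sigma> (i s))"

lemma act_index_in_multi_indices: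
  "\<sigma> permutes {1..n} \<Longrightarrow> i \<in> multi_indices n k \<Longrightarrow> act_index k \<sigma> i \<in> multi_indices n k"
  unfolding multi_indices_def act_index_def
  by (auto simp: PiE_iff permutes_in_image simp del: atLeastAtMost_iff)

lemma act_index_inv:
  assumes "\<sigma> permutes {1..n}" "i \<in> multi_indices n k"
  shows "act_index k \<sigma> (act_index k (inv \<sigma>) i) = i" "act_index k (inv \<sigma>) (act_index k \<sigma> i) = i"
  using multi_indices_extensional[OF assms(2)] permutes_inverses[OF assms(1)]
  by (auto simp: act_index_def fun_eq_iff extensional_def restrict_def)

lemma bij_betw_act_index:
  assumes "\<sigma> permutes {1..n}"
  shows "bij_betw (act_index k \<sigma>) (multi_indices n k) (multi_indices n k)"
  using assms permutes_inv[OF assms]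
  by (intro bij_betw_byWitness[where f' = "act_index k (inv \<sigma>)"])
    (auto simp: act_index_inv act_index_in_multi_indices)

lemma perm_act_v:
  assumes "y \<in> {1..n}"
  shows "perm_act n \<sigma> (v y) = v (\<sigma> y)"
proof
  fix x
  have "perm_act n \<sigma> (v y) x = (\<Sum>i\<in>{1..n}. if i = y then v (\<sigma> i) x else 0)"
    unfolding perm_act_def sum_apply by (rule sum.cong) (auto simp: fun_scale_def v_def)
  then show "perm_act n \<sigma> (v y) x = v (\<sigma> y) x"
    using assms by simp
qed

lemma tensor_perm_act_v:
  assumes "\<sigma> permutes {1..n}" "j \<in> multi_indices n k"
  shows "tensor k (\<lambda>s. perm_act n \<sigma> (v (j s))) i = (if i = act_index k \<sigma> j then 1 else 0)"
proof -
  have "tensor k (\<lambda>s. perm_act n \<sigma> (v (j s))) = tensor k (\<lambda>s. v (act_index k \<sigma> j s))"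
    using multi_indices_range[OF assms(2)]
    by (auto simp: tensor_def fun_eq_iff perm_act_v act_index_def intro!: prod.cong)
  then show ?thesis
    using tensor_basis[OF act_index_in_multi_indices[OF assms]] by simp
qed

lemma tensor_map_perm_act_apply:
  assumes "\<sigma> permutes {1..n}" "i \<in> multi_indices n k"
  shows "tensor_map n k (perm_act n \<sigma>) x (act_index k \<sigma> i) = x i"
proof -
  have "act_index k \<sigma> i = act_index k \<sigma> j \<longleftrightarrow> i = j" if "j \<in> multi_indices n k" for j
    using act_index_inv(2)[OF assms(1)] assms(2) that by metis
  then have "tensor_map n k (perm_act n \<sigma>) x (act_index k \<sigma> i) =
      (\<Sum>j\<in>multi_indices n k. x j * (if i = j then 1 else 0))"
    unfolding tensor_map_apply by (intro sum.cong) (auto simp: tensor_perm_act_v[OF assms(1)])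
  then show ?thesis using assms(2) by (simp add: if_distrib cong: if_cong)
qed

lemma tensor_map_perm_act_outside:
  assumes "\<sigma> permutes {1..n}" "i \<notin> multi_indices n k"
  shows "tensor_map n k (perm_act n \<sigma>) x i = 0"
  unfolding tensor_map_apply
  using assms act_index_in_multi_indices[OF assms(1)]
  by (intro sum.neutral) (auto simp: tensor_perm_act_v)

text \<open>
  Permuted tensors are recognised by their coordinates at permuted indices; this avoids
  inverses of permutations in all equivariance proofs.
\<close>

lemma perm_act_eqI:
  assumes \<sigma>: "\<sigma> permutes {1..n}"
    and "\<And>i. i \<in> multi_indices n k \<Longrightarrow> y (act_index k \<sigma> i) = x i"
    and "\<And>i. i \<notin> multi_indices n k \<Longrightarrow> y i = 0"
  shows "y = tensor_map n k (perm_act n \<sigma>) x"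
proof
  fix i
  show "y i = tensor_map n k (perm_act n \<sigma>) x i"
  proof (cases "i \<in> multi_indices n k")
    case True
    then obtain i0 where "i0 \<in> multi_indices n k" "i = act_index k \<sigma> i0"
      using bij_betw_act_index[OF \<sigma>, of k] by (auto simp: bij_betw_def)
    then show ?thesis using assms(2) \<sigma> by (simp add: tensor_map_perm_act_apply)
  next
    case False
    then show ?thesis using assms(3) \<sigma> by (simp add: tensor_map_perm_act_outside)
  qed
qed

lemma proj_kernel_act_index:
  assumes "\<sigma> permutes {1..n}"
  shows "proj_kernel n k (act_index k \<sigma> i) (act_index k \<sigma> j) = proj_kernel n k i j"
  using permutes_inj[OF assms]
  by (auto simp: proj_kernel_def act_index_def proj_coeff_def inj_eq intro!: prod.cong)

lemma tensor_map_proj_perm_act: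
  assumes \<sigma>: "\<sigma> permutes {1..n}"
  shows "tensor_map n k (proj n) (tensor_map n k (perm_act n \<sigma>) x) =
    tensor_map n k (perm_act n \<sigma>) (tensor_map n k (proj n) x)"
proof (rule perm_act_eqI[OF \<sigma>])
  fix i assume i: "i \<in> multi_indices n k"
  let ?y = "tensor_map n k (perm_act n \<sigma>) x"
  have "tensor_map n k (proj n) ?y (act_index k \<sigma> i) =
      (\<Sum>j\<in>multi_indices n k. proj_kernel n k (act_index k \<sigma> i) j * ?y j)"
    using act_index_in_multi_indices[OF \<sigma> i] by (simp add: tensor_map_proj_apply)
  also have "\<dots> = (\<Sum>j\<in>multi_indices n k.
      proj_kernel n k (act_index k \<sigma> i) (act_index k \<sigma> j) * ?y (act_index k \<sigma> j))"
    by (rule sum.reindex_bij_betw[OF bij_betw_act_index[OF \<sigma>], symmetric])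
  also have "\<dots> = tensor_map n k (proj n) x i"
    using i \<sigma> by (simp add: tensor_map_proj_apply tensor_map_perm_act_apply proj_kernel_act_index)
  finally show "tensor_map n k (proj n) ?y (act_index k \<sigma> i) = tensor_map n k (proj n) x i" .
qed (simp add: tensor_map_proj_apply)

lemma perm_act_in_W_tensor:
  assumes "\<sigma> permutes {1..n}" "x \<in> W_tensor n k"
  shows "tensor_map n k (perm_act n \<sigma>) x \<in> W_tensor n k"
  by (metis assms tensor_map_proj_perm_act tensor_map_proj_W_tensor tensor_map_proj_in_W_tensor)

section \<open>Operators given by functions of labellings\<close>

text \<open>
  Matrices are indexed by a single labelling of both rows rather than by a pair of
  multi-indices, because the blocks of a diagram do not distinguish the rows.
\<close>

definition kernel_apply :: "nat \<Rightarrow> nat \<Rightarrow> ((nat + nat \<Rightarrow> nat) \<Rightarrow> complex) \<Rightarrow> ctensor \<Rightarrow> ctensor"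
  where "kernel_apply n k f x = (\<lambda>i. \<Sum>j\<in>multi_indices n k. f (case_sum i j) * x j)"

definition kernel_op :: "nat \<Rightarrow> nat \<Rightarrow> ((nat + nat \<Rightarrow> nat) \<Rightarrow> complex) \<Rightarrow> ctensor \<Rightarrow> ctensor"
  where "kernel_op n k f =
    (\<lambda>x. if x \<in> W_tensor n k then tensor_map n k (proj n) (kernel_apply n k f x) else 0)"

definition diagram_fn :: "diagram \<Rightarrow> (nat + nat \<Rightarrow> nat) \<Rightarrow> complex"
  where "diagram_fn d g = of_bool (\<forall>B\<in>d. \<forall>s\<in>B. \<forall>t\<in>B. g s = g t)"

lemma bar_eq_kernel_op: "bar n k d = kernel_op n k (diagram_fn d)"
proof -
  have "tensor_map n k (proj n) (diagram_act n k d x) =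
      tensor_map n k (proj n) (kernel_apply n k (diagram_fn d) x)" for x
    by (rule tensor_map_cong)
      (simp add: diagram_act_apply kernel_apply_def diagram_fn_def compatible_def)
  then show ?thesis by (auto simp: bar_def kernel_op_def)
qed

lemma linear_kernel_op: "Vector_Spaces.linear fun_scale op_scale (kernel_op n k)"
proof -
  interpret L: Vector_Spaces.linear fun_scale fun_scale "tensor_map n k (proj n)"
    by (rule linear_tensor_map)
  have "kernel_apply n k (f + g) x = kernel_apply n k f x + kernel_apply n k g x" for f g x
    by (simp add: kernel_apply_def fun_eq_iff algebra_simps sum.distrib)
  moreover have "kernel_apply n k (fun_scale c f) x = fun_scale c (kernel_apply n k f x)" for c f x
    by (simp add: kernel_apply_def fun_eq_iff fun_scale_def algebra_simps sum_distrib_left)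
  ultimately have "kernel_op n k (f + g) = kernel_op n k f + kernel_op n k g"
    "kernel_op n k (fun_scale c f) = op_scale c (kernel_op n k f)" for f g c
    by (auto intro!: ext[of "kernel_op _ _ _"] simp: kernel_op_def L.add L.scale op_scale_def)
  then show ?thesis
    by unfold_locales auto
qed

lemma kernel_op_cong:
  assumes "\<And>i j. i \<in> multi_indices n k \<Longrightarrow> j \<in> multi_indices n k \<Longrightarrow>
    f (case_sum i j) = f' (case_sum i j)"
  shows "kernel_op n k f = kernel_op n k f'"
proof -
  have "tensor_map n k (proj n) (kernel_apply n k f x) =
      tensor_map n k (proj n) (kernel_apply n k f' x)" for x
    using assms by (intro tensor_map_cong) (auto simp: kernel_apply_def intro!: sum.cong)
  then show ?thesis by (auto simp: kernel_op_def)
qed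

lemma kernel_apply_linear:
  "kernel_apply n k f (x + y) = kernel_apply n k f x + kernel_apply n k f y"
  "kernel_apply n k f (fun_scale c x) = fun_scale c (kernel_apply n k f x)"
  by (auto simp: kernel_apply_def fun_eq_iff fun_scale_def algebra_simps sum.distrib sum_distrib_left)

text \<open>
  An invariant matrix commutes with the group, and so does \<open>\<pi>\<^sup>\<otimes>\<^sup>k\<close>.
\<close>

lemma kernel_op_in_quasi_partition_algebra:
  assumes inv: "\<And>\<sigma> i j. \<sigma> permutes {1..n} \<Longrightarrow> i \<in> multi_indices n k \<Longrightarrow> j \<in> multi_indices n k \<Longrightarrow>
    f (case_sum (act_index k \<sigma> i) (act_index k \<sigma> j)) = f (case_sum i j)"
  shows "kernel_op n k f \<in> quasi_partition_algebra n k"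
proof -
  interpret L: Vector_Spaces.linear fun_scale fun_scale "tensor_map n k (proj n)"
    by (rule linear_tensor_map)
  have eq: "tensor_map n k (proj n) (kernel_apply n k f (tensor_map n k (perm_act n \<sigma>) x)) =
      tensor_map n k (perm_act n \<sigma>) (tensor_map n k (proj n) (kernel_apply n k f x))"
    if \<sigma>: "\<sigma> permutes {1..n}" for \<sigma> x
  proof -
    let ?y = "tensor_map n k (perm_act n \<sigma>) x"
    \<comment> \<open>\<open>kernel_apply\<close> need not vanish off the multi-indices, whereas permuted tensors do.\<close>
    let ?z = "\<lambda>i. if i \<in> multi_indices n k then kernel_apply n k f ?y i else 0"
    have "?z = tensor_map n k (perm_act n \<sigma>) (kernel_apply n k f x)"
    proof (rule perm_act_eqI[OF \<sigma>])
      fix i assume i: "i \<in> multi_indices n k"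
      have "?z (act_index k \<sigma> i) =
          (\<Sum>j\<in>multi_indices n k. f (case_sum (act_index k \<sigma> i) j) * ?y j)"
        using act_index_in_multi_indices[OF \<sigma> i] by (simp add: kernel_apply_def)
      also have "\<dots> = (\<Sum>j\<in>multi_indices n k.
          f (case_sum (act_index k \<sigma> i) (act_index k \<sigma> j)) * ?y (act_index k \<sigma> j))"
        by (rule sum.reindex_bij_betw[OF bij_betw_act_index[OF \<sigma>], symmetric])
      also have "\<dots> = kernel_apply n k f x i"
        using i \<sigma> by (simp add: kernel_apply_def tensor_map_perm_act_apply inv)
      finally show "?z (act_index k \<sigma> i) = kernel_apply n k f x i" .
    qed auto
    moreover have "tensor_map n k (proj n) (kernel_apply n k f ?y) = tensor_map n k (proj n) ?z"
      by (rule tensor_map_cong) simp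
    ultimately show ?thesis using tensor_map_proj_perm_act[OF \<sigma>] by simp
  qed
  show ?thesis
    unfolding quasi_partition_algebra_def
    using fun_vs.subspace_add[OF subspace_W_tensor, of _ n k]
      fun_vs.subspace_scale[OF subspace_W_tensor, of _ n k]
    by (auto simp: kernel_op_def tensor_map_proj_in_W_tensor kernel_apply_linear L.add L.scale
        perm_act_in_W_tensor eq)
qed

lemma bar_in_quasi_partition_algebra:
  assumes "d \<in> partition_diagrams k"
  shows "bar n k d \<in> quasi_partition_algebra n k"
  unfolding bar_eq_kernel_op
proof (rule kernel_op_in_quasi_partition_algebra)
  fix \<sigma> i j assume \<sigma>: "\<sigma> permutes {1..n}"
  have X: "B \<subseteq> {1..k} <+> {1..k}" if "B \<in> d" for B
    using assms that by (auto simp: partition_diagrams_def partition_on_def)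
  have lab: "case_sum (act_index k \<sigma> i) (act_index k \<sigma> j) s = \<sigma> (case_sum i j s)"
    if "s \<in> {1..k} <+> {1..k}" for s
    using that by (auto simp: act_index_def)
  have "case_sum (act_index k \<sigma> i) (act_index k \<sigma> j) s = case_sum (act_index k \<sigma> i) (act_index k \<sigma> j) t
     \<longleftrightarrow> case_sum i j s = case_sum i j t" if "B \<in> d" "s \<in> B" "t \<in> B" for B s t
  proof -
    have "s \<in> {1..k} <+> {1..k}" "t \<in> {1..k} <+> {1..k}" using X that by auto
    then show ?thesis by (simp only: lab inj_eq[OF permutes_inj[OF \<sigma>]])
  qed
  then show "diagram_fn d (case_sum (act_index k \<sigma> i) (act_index k \<sigma> j)) = diagram_fn d (case_sum i j)"
    unfolding diagram_fn_def by (intro arg_cong[where f = of_bool] ball_cong refl)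
qed

lemma subspace_quasi_partition_algebra: "op_vs.subspace (quasi_partition_algebra n k)"
proof (rule op_vs.subspaceI)
  interpret L: Vector_Spaces.linear fun_scale fun_scale "tensor_map n k f" for f
    by (rule linear_tensor_map)
  note W = subspace_W_tensor[of n k]
  show "0 \<in> quasi_partition_algebra n k"
    using fun_vs.subspace_0[OF W] by (simp add: quasi_partition_algebra_def L.zero)
  show "F + G \<in> quasi_partition_algebra n k"
    if "F \<in> quasi_partition_algebra n k" "G \<in> quasi_partition_algebra n k" for F G
    using that fun_vs.subspace_add[OF W]
    by (simp add: quasi_partition_algebra_def L.add fun_vs.scale_right_distrib add_ac)
  show "op_scale c F \<in> quasi_partition_algebra n k" if "F \<in> quasi_partition_algebra n k" for c F
    using that fun_vs.subspace_scale[OF W]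
    by (simp add: quasi_partition_algebra_def op_scale_def L.scale fun_vs.scale_right_distrib
        fun_vs.scale_left_commute)
qed


section \<open>Diagrams and labellings of their vertices\<close>

abbreviation vertices :: "nat \<Rightarrow> (nat + nat) set"
  where "vertices k \<equiv> {1..k} <+> {1..k}"

text \<open>
  A diagram is determined by its equivalence relation, and refinement of diagrams becomes
  inclusion of relations; all comparisons of diagrams are made through \<open>same_block\<close>.
\<close>

definition same_block :: "diagram \<Rightarrow> ((nat + nat) \<times> (nat + nat)) set"
  where "same_block d = {(s, t). \<exists>B\<in>d. s \<in> B \<and> t \<in> B}"

definition label_rel :: "nat \<Rightarrow> (nat + nat \<Rightarrow> nat) \<Rightarrow> ((nat + nat) \<times> (nat + nat)) set"
  where "label_rel k g = {(s, t). s \<in> vertices k \<and> t \<in> vertices k \<and> g s = g t}"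

text \<open>
  On labellings with values in \<open>{1..n}\<close>, this is the indicator function of an orbit of the
  symmetric group (or zero, if the diagram has more than \<open>n\<close> blocks).
\<close>

definition orbit_fn :: "nat \<Rightarrow> diagram \<Rightarrow> (nat + nat \<Rightarrow> nat) \<Rightarrow> complex"
  where "orbit_fn k d g = of_bool (label_rel k g = same_block d)"

lemma finite_partition_diagrams: "finite (partition_diagrams k)"
  unfolding partition_diagrams_def by (rule finitely_many_partition_on) auto

lemma block_subset_vertices: "d \<in> partition_diagrams k \<Longrightarrow> B \<in> d \<Longrightarrow> B \<subseteq> vertices k"
  by (auto simp: partition_diagrams_def partition_on_def)

lemma same_block_subset: "d \<in> partition_diagrams k \<Longrightarrow> same_block d \<subseteq> vertices k \<times> vertices k"
  using block_subset_vertices by (fastforce simp: same_block_def)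

lemma same_block_inject:
  assumes "d \<in> partition_diagrams k" "d' \<in> partition_diagrams k" "same_block d = same_block d'"
  shows "d = d'"
proof -
  have "vertices k // same_block e = e" if "e \<in> partition_diagrams k" for e
    using partition_on_eq_quotient[of "vertices k" e] that
    by (simp add: partition_diagrams_def same_block_def)
  then show ?thesis using assms by metis
qed

lemma block_unique:
  assumes "d \<in> partition_diagrams k" "B \<in> d" "B' \<in> d" "s \<in> B" "s \<in> B'"
  shows "B = B'"
  using assms partition_onD2 unfolding partition_diagrams_def disjoint_def by blast

lemma ex_diagram_label_rel:
  obtains d where "d \<in> partition_diagrams k" "same_block d = label_rel k g"
proof
  have eq: "equiv (vertices k) (label_rel k g)"
    by (rule equivI) (auto simp: label_rel_def refl_on_def sym_def trans_def)
  show "vertices k // label_rel k g \<in> partition_diagrams k"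
    unfolding partition_diagrams_def using partition_on_quotient[OF eq] by simp
  show "same_block (vertices k // label_rel k g) = label_rel k g"
    by (auto simp: same_block_def quotient_def label_rel_def)
qed

lemma diagram_fn_eq:
  assumes "d \<in> partition_diagrams k"
  shows "diagram_fn d g = of_bool (same_block d \<subseteq> label_rel k g)"
proof -
  have "(\<forall>B\<in>d. \<forall>s\<in>B. \<forall>t\<in>B. g s = g t) \<longleftrightarrow> same_block d \<subseteq> label_rel k g"
    using block_subset_vertices[OF assms] unfolding same_block_def label_rel_def by blast
  then show ?thesis by (simp add: diagram_fn_def)
qed

text \<open>
  A labelling \<open>g\<close> is constant on the blocks of \<open>d\<close> iff the diagram of \<open>g\<close>, whose blocks are the classes
  of equally labelled vertices, is \<open>d\<close> or coarser; this diagram is the only one whose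
  orbit function is nonzero at \<open>g\<close>.
\<close>

lemma diagram_fn_eq_sum_orbit_fn:
  assumes "d \<in> partition_diagrams k"
  shows "diagram_fn d = (\<Sum>d' | d' \<in> partition_diagrams k \<and> same_block d \<subseteq> same_block d'. orbit_fn k d')"
proof
  fix g
  obtain e where e: "e \<in> partition_diagrams k" "same_block e = label_rel k g"
    by (rule ex_diagram_label_rel)
  let ?S = "{d' \<in> partition_diagrams k. same_block d \<subseteq> same_block d'}"
  have "finite ?S" using finite_partition_diagrams by simp
  have "(\<Sum>d'\<in>?S. orbit_fn k d') g = (\<Sum>d'\<in>?S. orbit_fn k d' g)"
    by (rule sum_apply)
  also have "\<dots> = (\<Sum>d'\<in>?S. if d' = e then 1 else 0)"
  proof (rule sum.cong)
    fix d' assume "d' \<in> ?S"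
    then have "label_rel k g = same_block d' \<longleftrightarrow> d' = e"
      using e same_block_inject[of d' k e] by auto
    then show "orbit_fn k d' g = (if d' = e then 1 else 0)" by (simp add: orbit_fn_def)
  qed simp
  also have "\<dots> = of_bool (e \<in> ?S)"
    using \<open>finite ?S\<close> by (simp add: sum.delta)
  finally show "diagram_fn d g = (\<Sum>d'\<in>?S. orbit_fn k d') g"
    using e by (simp add: diagram_fn_eq[OF assms])
qed

text \<open>
  The previous sum is unitriangular for refinement, so it can be inverted by induction from
  the coarsest diagram downwards; this replaces an explicit Moebius inversion.
\<close>

lemma orbit_fn_in_span:
  "d \<in> partition_diagrams k \<Longrightarrow> orbit_fn k d \<in> fun_vs.span (diagram_fn ` partition_diagrams k)"
proof (induction "card (vertices k \<times> vertices k) - card (same_block d)" arbitrary: d rule: less_induct)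
  case less
  let ?S = "{d' \<in> partition_diagrams k. same_block d \<subseteq> same_block d'}"
  have fin: "finite ?S" using finite_partition_diagrams by simp
  have "orbit_fn k d = diagram_fn d - (\<Sum>d'\<in>?S - {d}. orbit_fn k d')"
    using less.prems fin by (simp add: diagram_fn_eq_sum_orbit_fn[of d k] sum.remove[of ?S d])
  moreover have "orbit_fn k d' \<in> fun_vs.span (diagram_fn ` partition_diagrams k)"
    if d': "d' \<in> ?S - {d}" for d'
  proof (rule less.hyps)
    show "d' \<in> partition_diagrams k" using d' by simp
    have finX: "finite (vertices k \<times> vertices k)" by simp
    have "same_block d \<subset> same_block d'"
      using d' same_block_inject less.prems by blast
    moreover have "same_block d' \<subseteq> vertices k \<times> vertices k"
      using d' same_block_subset by blast
    ultimately have "card (same_block d) < card (same_block d')"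
      "card (same_block d') \<le> card (vertices k \<times> vertices k)"
      using finX by (meson finite_subset psubset_card_mono, meson card_mono)
    then show "card (vertices k \<times> vertices k) - card (same_block d')
        < card (vertices k \<times> vertices k) - card (same_block d)" by linarith
  qed
  ultimately show ?case
    using less.prems by (simp only:) (intro fun_vs.span_diff fun_vs.span_sum fun_vs.span_base[of "diagram_fn d"] imageI)
qed

text \<open>
  The correspondence of labels is a bijection between the two image sets; these have complements of equal
  size in \<open>A\<close>, so it extends to all of \<open>A\<close>.
\<close>

lemma ex_permutes_relabelling:
  assumes "finite A" and f: "f ` X \<subseteq> A" and f': "f' ` X \<subseteq> A"
    and eq: "\<And>s t. s \<in> X \<Longrightarrow> t \<in> X \<Longrightarrow> f s = f t \<longleftrightarrow> f' s = f' t"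
  obtains \<sigma> where "\<sigma> permutes A" "\<And>s. s \<in> X \<Longrightarrow> f' s = \<sigma> (f s)"
proof -
  define h where "h y = f' (inv_into X f y)" for y
  have h: "h (f s) = f' s" if "s \<in> X" for s
    unfolding h_def using that eq[of "inv_into X f (f s)" s]
    by (simp add: inv_into_into f_inv_into_f)
  have bij1: "bij_betw h (f ` X) (f' ` X)"
    unfolding bij_betw_def using h eq by (auto simp: inj_on_def image_image)
  have "card (A - f ` X) = card (A - f' ` X)"
    using assms bij_betw_same_card[OF bij1] by (simp add: card_Diff_subset finite_subset)
  then obtain h' where bij2: "bij_betw h' (A - f ` X) (A - f' ` X)"
    using assms(1) by (meson finite_Diff finite_same_card_bij)
  define \<sigma> where "\<sigma> x = (if x \<in> f ` X then h x else if x \<in> A then h' x else x)" for x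
  have "bij_betw \<sigma> (f ` X) (f' ` X)"
    using bij1 by (rule bij_betw_cong[THEN iffD1, rotated]) (simp add: \<sigma>_def)
  moreover have "bij_betw \<sigma> (A - f ` X) (A - f' ` X)"
    using bij2 by (rule bij_betw_cong[THEN iffD1, rotated]) (simp add: \<sigma>_def)
  ultimately have "bij_betw \<sigma> (f ` X \<union> (A - f ` X)) (f' ` X \<union> (A - f' ` X))"
    by (rule bij_betw_combine) auto
  then have "bij_betw \<sigma> A A" using f f' by (simp add: Un_absorb1)
  then have "\<sigma> permutes A"
    by (rule bij_imp_permutes) (use f in \<open>auto simp: \<sigma>_def\<close>)
  moreover have "f' s = \<sigma> (f s)" if "s \<in> X" for s
    using that h by (simp add: \<sigma>_def)
  ultimately show ?thesis by (rule that)
qed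

section \<open>The diagrams span\<close>

text \<open>The matrix of \<open>F \<circ> \<pi>\<^sup>\<otimes>\<^sup>k\<close>, as a function of labellings.\<close>

definition op_fn :: "nat \<Rightarrow> nat \<Rightarrow> (ctensor \<Rightarrow> ctensor) \<Rightarrow> (nat + nat \<Rightarrow> nat) \<Rightarrow> complex"
  where "op_fn n k F g = F (tensor k (\<lambda>s. proj n (v (g (Inr s))))) (\<lambda>s\<in>{1..k}. g (Inl s))"

lemma op_fn_case_sum:
  "i \<in> multi_indices n k \<Longrightarrow>
    op_fn n k F (case_sum i j) = F (tensor k (\<lambda>s. proj n (v (j s)))) i"
  using multi_indices_extensional[of i n k] by (simp add: op_fn_def extensional_restrict)

lemma tensor_proj_v_in_W_tensor:
  "j \<in> multi_indices n k \<Longrightarrow> tensor k (\<lambda>s. proj n (v (j s))) \<in> W_tensor n k"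
  by (intro tensor_in_W_tensor proj_v_in_W) (rule multi_indices_range)

lemma endomorphism_sum:
  assumes "F \<in> quasi_partition_algebra n k" "finite A" "\<And>a. a \<in> A \<Longrightarrow> y a \<in> W_tensor n k"
  shows "F (\<Sum>a\<in>A. fun_scale (c a) (y a)) = (\<Sum>a\<in>A. fun_scale (c a) (F (y a)))"
  using assms(2,3)
proof (induction A)
  case empty
  have "F (fun_scale 0 0) = fun_scale 0 (F 0)"
    using assms(1) fun_vs.subspace_0[OF subspace_W_tensor]
    unfolding quasi_partition_algebra_def by blast
  then show ?case unfolding fun_vs.scale_zero_left sum.empty .
next
  case (insert a A)
  have "fun_scale (c a) (y a) \<in> W_tensor n k" "(\<Sum>a\<in>A. fun_scale (c a) (y a)) \<in> W_tensor n k"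
    using insert.prems
    by (auto intro!: fun_vs.subspace_scale[OF subspace_W_tensor] fun_vs.subspace_sum[OF subspace_W_tensor])
  then have "F (fun_scale (c a) (y a) + (\<Sum>a\<in>A. fun_scale (c a) (y a)))
      = F (fun_scale (c a) (y a)) + F (\<Sum>a\<in>A. fun_scale (c a) (y a))"
    using assms(1) by (auto simp: quasi_partition_algebra_def)
  moreover have "F (fun_scale (c a) (y a)) = fun_scale (c a) (F (y a))"
    using assms(1) insert.prems by (auto simp: quasi_partition_algebra_def)
  moreover have "F (\<Sum>a\<in>A. fun_scale (c a) (y a)) = (\<Sum>a\<in>A. fun_scale (c a) (F (y a)))"
    using insert by blast
  ultimately show ?case
    unfolding sum.insert[OF insert.hyps] by (simp only:)
qed

text \<open>
  On \<open>W\<^sup>\<otimes>\<^sup>k\<close> one has \<open>F x = F (\<pi>\<^sup>\<otimes>\<^sup>k x)\<close>, and expanding \<open>x\<close> in coordinates expresses this by the matrix of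
  \<open>F \<circ> \<pi>\<^sup>\<otimes>\<^sup>k\<close>; the final projection in \<open>kernel_op\<close> does not change \<open>F x \<in> W\<^sup>\<otimes>\<^sup>k\<close>.
\<close>

lemma endomorphism_eq_kernel_op:
  assumes F: "F \<in> quasi_partition_algebra n k"
  shows "F = kernel_op n k (op_fn n k F)"
proof
  fix x
  show "F x = kernel_op n k (op_fn n k F) x"
  proof (cases "x \<in> W_tensor n k")
    case True
    have "F x = F (tensor_map n k (proj n) x)"
      using tensor_map_proj_W_tensor[OF True] by simp
    also have "\<dots> = (\<Sum>j\<in>multi_indices n k. fun_scale (x j) (F (tensor k (\<lambda>s. proj n (v (j s))))))"
      unfolding tensor_map_def using F tensor_proj_v_in_W_tensor by (intro endomorphism_sum) auto
    finally have "F x i = (\<Sum>j\<in>multi_indices n k. x j * F (tensor k (\<lambda>s. proj n (v (j s)))) i)" for i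
      by (simp add: sum_apply fun_scale_def)
    then have "tensor_map n k (proj n) (F x) = tensor_map n k (proj n) (kernel_apply n k (op_fn n k F) x)"
      by (intro tensor_map_cong) (simp add: kernel_apply_def op_fn_case_sum mult.commute)
    moreover have "F x \<in> W_tensor n k"
      using F True by (auto simp: quasi_partition_algebra_def)
    ultimately show ?thesis
      using True tensor_map_proj_W_tensor by (simp add: kernel_op_def)
  next
    case False
    then show ?thesis using F by (simp add: kernel_op_def quasi_partition_algebra_def)
  qed
qed

lemma op_fn_act_index:
  assumes F: "F \<in> quasi_partition_algebra n k" and \<sigma>: "\<sigma> permutes {1..n}"
    and i: "i \<in> multi_indices n k" and j: "j \<in> multi_indices n k"
  shows "op_fn n k F (case_sum (act_index k \<sigma> i) (act_index k \<sigma> j)) = op_fn n k F (case_sum i j)"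
proof -
  let ?e = "\<lambda>j. tensor k (\<lambda>s. proj n (v (j s)))"
  note act = act_index_in_multi_indices[OF \<sigma>]
  have "?e (act_index k \<sigma> j) = tensor_map n k (perm_act n \<sigma>) (?e j)"
    using act j by (intro perm_act_eqI[OF \<sigma>])
      (simp_all add: tensor_proj_v proj_kernel_act_index[OF \<sigma>])
  then have "F (?e (act_index k \<sigma> j)) = tensor_map n k (perm_act n \<sigma>) (F (?e j))"
    using F \<sigma> tensor_proj_v_in_W_tensor[OF j] by (simp add: quasi_partition_algebra_def)
  then show ?thesis
    using i act[OF i] by (simp add: op_fn_case_sum tensor_map_perm_act_apply[OF \<sigma>])
qed

lemma op_fn_eq_if_label_rel_eq:
  assumes F: "F \<in> quasi_partition_algebra n k"
    and i: "i \<in> multi_indices n k" and j: "j \<in> multi_indices n k"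
    and i': "i' \<in> multi_indices n k" and j': "j' \<in> multi_indices n k"
    and eq: "label_rel k (case_sum i j) = label_rel k (case_sum i' j')"
  shows "op_fn n k F (case_sum i j) = op_fn n k F (case_sum i' j')"
proof -
  obtain \<sigma> where \<sigma>: "\<sigma> permutes {1..n}"
    and lab: "\<And>s. s \<in> vertices k \<Longrightarrow> case_sum i' j' s = \<sigma> (case_sum i j s)"
  proof (rule ex_permutes_relabelling[of "{1..n}" "case_sum i j" "vertices k" "case_sum i' j'"])
    show "case_sum i j ` vertices k \<subseteq> {1..n}" "case_sum i' j' ` vertices k \<subseteq> {1..n}"
      using multi_indices_range[OF i] multi_indices_range[OF j]
        multi_indices_range[OF i'] multi_indices_range[OF j'] by (auto simp: image_iff)
    show "case_sum i j s = case_sum i j t \<longleftrightarrow> case_sum i' j' s = case_sum i' j' t"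
      if "s \<in> vertices k" "t \<in> vertices k" for s t
      using that eq unfolding label_rel_def by blast
  qed auto
  have "i' = act_index k \<sigma> i"
    by (rule extensionalityI[OF multi_indices_extensional[OF i']])
      (use lab[OF InlI] in \<open>auto simp: act_index_def\<close>)
  moreover have "j' = act_index k \<sigma> j"
    by (rule extensionalityI[OF multi_indices_extensional[OF j']])
      (use lab[OF InrI] in \<open>auto simp: act_index_def\<close>)
  ultimately show ?thesis using op_fn_act_index[OF F \<sigma> i j] by simp
qed

lemma span_bar_partition_diagrams:
  assumes F: "F \<in> quasi_partition_algebra n k"
  shows "F \<in> op_vs.span (bar n k ` partition_diagrams k)"
proof -
  interpret L: Vector_Spaces.linear fun_scale op_scale "kernel_op n k"
    by (rule linear_kernel_op)
  let ?P = "\<lambda>d p. fst p \<in> multi_indices n k \<and> snd p \<in> multi_indices n k \<and>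
    label_rel k (case_sum (fst p) (snd p)) = same_block d"
  \<comment> \<open>The value of the matrix on the orbit of \<open>d\<close>. If \<open>d\<close> has more than \<open>n\<close> blocks, the orbit is empty
    and the arbitrary value chosen by \<open>SOME\<close> is multiplied by zero.\<close>
  define c where "c d = (let p = SOME p. ?P d p in op_fn n k F (case_sum (fst p) (snd p)))" for d
  let ?f = "\<Sum>d\<in>partition_diagrams k. fun_scale (c d) (orbit_fn k d)"
  have "kernel_op n k (op_fn n k F) = kernel_op n k ?f"
  proof (rule kernel_op_cong)
    fix i j assume ij: "i \<in> multi_indices n k" "j \<in> multi_indices n k"
    let ?g = "case_sum i j"
    obtain e where e: "e \<in> partition_diagrams k" "same_block e = label_rel k ?g"
      by (rule ex_diagram_label_rel)
    have "?P e (SOME p. ?P e p)"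
      using ij e by (intro someI[of "?P e" "(i, j)"]) auto
    then have c: "c e = op_fn n k F ?g"
      unfolding c_def Let_def using ij e by (intro op_fn_eq_if_label_rel_eq[OF F]) auto
    have "?f ?g = (\<Sum>d\<in>partition_diagrams k. fun_scale (c d) (orbit_fn k d) ?g)"
      by (rule sum_apply)
    also have "\<dots> = (\<Sum>d\<in>partition_diagrams k. if d = e then c d else 0)"
    proof (rule sum.cong)
      fix d assume "d \<in> partition_diagrams k"
      then have "label_rel k ?g = same_block d \<longleftrightarrow> d = e"
        using e same_block_inject[of d k e] by auto
      then show "fun_scale (c d) (orbit_fn k d) ?g = (if d = e then c d else 0)"
        by (simp add: orbit_fn_def fun_scale_def)
    qed simp
    also have "\<dots> = c e"
      using e finite_partition_diagrams by simp
    finally show "op_fn n k F ?g = ?f ?g" using c by simp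
  qed
  then have "F = kernel_op n k ?f" using endomorphism_eq_kernel_op[OF F] by simp
  moreover have "?f \<in> fun_vs.span (diagram_fn ` partition_diagrams k)"
    by (intro fun_vs.span_sum fun_vs.span_scale orbit_fn_in_span)
  ultimately have "F \<in> kernel_op n k ` fun_vs.span (diagram_fn ` partition_diagrams k)" by blast
  also have "\<dots> = op_vs.span (kernel_op n k ` diagram_fn ` partition_diagrams k)"
    by (rule L.span_image[symmetric])
  also have "kernel_op n k ` diagram_fn ` partition_diagrams k = bar n k ` partition_diagrams k"
    by (simp add: image_image bar_eq_kernel_op)
  finally show ?thesis .
qed

section \<open>Isolated vertices\<close>

text \<open>The sum over the label at \<open>s\<close> factors out, since \<open>h\<close> does not depend on it.\<close>

lemma sum_multi_indices_zero:
  assumes s: "s \<in> {1..k}" and "(\<Sum>y\<in>{1..n}. w s y) = 0" and h: "\<And>j y. h (j(s := y)) = h j"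
  shows "(\<Sum>j\<in>multi_indices n k. h j * (\<Prod>t\<in>{1..k}. w t (j t))) = (0 :: complex)"
proof -
  let ?S = "{1..k} - {s}"
  let ?G = "\<lambda>(y, g). g(s := y)"
  have ins: "{1..k} = insert s ?S" using s by auto
  have "multi_indices n k = ?G ` ({1..n} \<times> (?S \<rightarrow>\<^sub>E {1..n}))"
    unfolding multi_indices_def by (subst ins, rule PiE_insert_eq)
  moreover have "inj_on ?G ({1..n} \<times> (?S \<rightarrow>\<^sub>E {1..n}))"
    by (rule inj_combinator) simp
  ultimately have "(\<Sum>j\<in>multi_indices n k. h j * (\<Prod>t\<in>{1..k}. w t (j t))) =
      (\<Sum>(y, g)\<in>{1..n} \<times> (?S \<rightarrow>\<^sub>E {1..n}). h (g(s := y)) * (\<Prod>t\<in>{1..k}. w t ((g(s := y)) t)))"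
    by (simp only: sum.reindex) (simp add: case_prod_unfold)
  also have "\<dots> = (\<Sum>(y, g)\<in>{1..n} \<times> (?S \<rightarrow>\<^sub>E {1..n}). w s y * (h g * (\<Prod>t\<in>?S. w t (g t))))"
  proof (rule sum.cong, simp, clarify)
    fix y g
    have "(\<Prod>t\<in>{1..k}. w t ((g(s := y)) t)) = w s y * (\<Prod>t\<in>?S. w t ((g(s := y)) t))"
      using s by (subst prod.remove[of _ s]) auto
    also have "(\<Prod>t\<in>?S. w t ((g(s := y)) t)) = (\<Prod>t\<in>?S. w t (g t))"
      by (rule prod.cong) auto
    finally show "h (g(s := y)) * (\<Prod>t\<in>{1..k}. w t ((g(s := y)) t)) =
        w s y * (h g * (\<Prod>t\<in>?S. w t (g t)))"
      using h by simp
  qed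
  also have "\<dots> = (\<Sum>y\<in>{1..n}. w s y) * (\<Sum>g\<in>?S \<rightarrow>\<^sub>E {1..n}. h g * (\<Prod>t\<in>?S. w t (g t)))"
    by (simp only: sum.cartesian_product[symmetric] sum_product)
  finally show ?thesis using assms(2) by simp
qed

lemma diagram_fn_isolated:
  assumes d: "d \<in> partition_diagrams k" and a: "{a} \<in> d" and g: "\<And>s. s \<noteq> a \<Longrightarrow> g s = g' s"
  shows "diagram_fn d g = diagram_fn d g'"
proof -
  have "(g s = g t) = (g' s = g' t)" if "B \<in> d" "s \<in> B" "t \<in> B" for B s t
  proof (cases "a \<in> B")
    case True
    then have "B = {a}"
      using block_unique[OF d \<open>B \<in> d\<close> a] by simp
    then show ?thesis using that by auto
  next
    case False
    then show ?thesis using that g by metis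
  qed
  then show ?thesis
    unfolding diagram_fn_def by (intro arg_cong[where f = of_bool] ball_cong refl)
qed

lemma sum_proj_coeff:
  assumes "x \<in> {1..n}"
  shows "(\<Sum>y\<in>{1..n}. proj_coeff n x y) = 0"
  using assms by (auto simp: proj_coeff_def sum_subtractf of_bool_def)

text \<open>The rows of the matrix of \<open>\<pi>\<close> have sum zero.\<close>

lemma bar_isolated_top:
  assumes d: "d \<in> partition_diagrams k" and s: "s \<in> {1..k}" and iso: "{Inl s} \<in> d"
  shows "bar n k d = 0"
proof -
  have "tensor_map n k (proj n) (kernel_apply n k (diagram_fn d) x) = 0" for x
  proof
    fix i
    have "(\<Sum>j\<in>multi_indices n k. kernel_apply n k (diagram_fn d) x j * (\<Prod>t\<in>{1..k}. proj_coeff n (i t) (j t))) = 0"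
      if "i \<in> multi_indices n k"
    proof (rule sum_multi_indices_zero[OF s, where w = "\<lambda>t. proj_coeff n (i t)"])
      show "(\<Sum>y\<in>{1..n}. proj_coeff n (i s) y) = 0"
        using that s multi_indices_range by (intro sum_proj_coeff) blast
      show "kernel_apply n k (diagram_fn d) x (j(s := y)) = kernel_apply n k (diagram_fn d) x j" for j y
        unfolding kernel_apply_def
        by (intro sum.cong refl arg_cong2[where f = "(*)"] diagram_fn_isolated[OF d iso])
          (auto split: sum.split)
    qed
    then show "tensor_map n k (proj n) (kernel_apply n k (diagram_fn d) x) i = 0 i"
      by (simp add: tensor_map_proj_apply proj_kernel_def mult.commute)
  qed
  then show ?thesis by (auto simp: bar_eq_kernel_op kernel_op_def)
qed

text \<open>Vectors of \<open>W\<close> have coordinate sum zero.\<close>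

lemma bar_isolated_bottom:
  assumes d: "d \<in> partition_diagrams k" and s: "s \<in> {1..k}" and iso: "{Inr s} \<in> d"
  shows "bar n k d = 0"
proof -
  have "kernel_apply n k (diagram_fn d) x = 0" if "x \<in> W_tensor n k" for x
    using that unfolding W_tensor_def
  proof (induction rule: fun_vs.span_induct_alt)
    case base
    show ?case by (simp add: kernel_apply_def fun_eq_iff)
  next
    case (step c x y)
    then obtain w where x: "x = tensor k w" and w: "\<forall>s\<in>{1..k}. w s \<in> W n" by auto
    have "kernel_apply n k (diagram_fn d) x i = 0" for i
    proof -
      have "kernel_apply n k (diagram_fn d) x i =
          (\<Sum>j\<in>multi_indices n k. diagram_fn d (case_sum i j) * (\<Prod>t\<in>{1..k}. w t (j t)))"
        unfolding kernel_apply_def x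
        by (intro sum.cong refl) (auto simp: tensor_def dest: multi_indices_extensional)
      also have "\<dots> = 0"
      proof (rule sum_multi_indices_zero[OF s])
        show "(\<Sum>y\<in>{1..n}. w s y) = 0" using w s W_coordinates by blast
        show "diagram_fn d (case_sum i (j(s := y))) = diagram_fn d (case_sum i j)" for j y
          by (rule diagram_fn_isolated[OF d iso]) (auto split: sum.split)
      qed
      finally show ?thesis .
    qed
    then have "kernel_apply n k (diagram_fn d) x = 0" by (simp add: fun_eq_iff)
    then show ?case unfolding kernel_apply_linear using step.IH by (simp add: fun_scale_def fun_eq_iff)
  qed
  moreover have "tensor_map n k (proj n) 0 = 0"
    by (simp add: fun_eq_iff tensor_map_apply)
  ultimately show ?thesis by (auto simp: bar_eq_kernel_op kernel_op_def)
qed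

lemma bar_isolated:
  assumes d: "d \<in> partition_diagrams k" and "d \<notin> diagrams_no_singletons k"
  shows "bar n k d = 0"
proof -
  obtain a where a: "{a} \<in> d"
    using assms by (auto simp: diagrams_no_singletons_def card_1_singleton_iff)
  then have "a \<in> vertices k" using block_subset_vertices[OF d] by blast
  then show ?thesis
    using a bar_isolated_top[OF d] bar_isolated_bottom[OF d] by (cases a) auto
qed

section \<open>Linear independence\<close>

text \<open>
  The projection in \<open>kernel_op\<close> drops out of the pairing: its matrix is symmetric, so it can be moved
  to the tensor of the top vectors, which it fixes.
\<close>

lemma kernel_op_pairing:
  assumes u: "\<And>s. s \<in> vertices k \<Longrightarrow> u s \<in> W n"
  shows "(\<Sum>i\<in>multi_indices n k. tensor k (\<lambda>s. u (Inl s)) i * kernel_op n k f (tensor k (\<lambda>s. u (Inr s))) i) =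
    (\<Sum>(i, j)\<in>multi_indices n k \<times> multi_indices n k.
      f (case_sum i j) * (\<Prod>s\<in>vertices k. u s (case_sum i j s)))"
proof -
  let ?I = "multi_indices n k"
  let ?y = "tensor k (\<lambda>s. u (Inl s))"
  let ?x = "tensor k (\<lambda>s. u (Inr s))"
  let ?z = "kernel_apply n k f ?x"
  have y: "?y \<in> W_tensor n k" and x: "?x \<in> W_tensor n k"
    using u by (auto intro!: tensor_in_W_tensor simp del: One_nat_def)
  have "(\<Sum>i\<in>?I. ?y i * kernel_op n k f ?x i) = (\<Sum>i\<in>?I. \<Sum>i'\<in>?I. ?y i * (proj_kernel n k i i' * ?z i'))"
    using x by (simp add: kernel_op_def tensor_map_proj_apply sum_distrib_left)
  also have "\<dots> = (\<Sum>i'\<in>?I. \<Sum>i\<in>?I. ?y i * (proj_kernel n k i i' * ?z i'))"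
    by (rule sum.swap)
  also have "\<dots> = (\<Sum>i'\<in>?I. tensor_map n k (proj n) ?y i' * ?z i')"
  proof (intro sum.cong refl)
    fix i' assume "i' \<in> ?I"
    then show "(\<Sum>i\<in>?I. ?y i * (proj_kernel n k i i' * ?z i')) = tensor_map n k (proj n) ?y i' * ?z i'"
      by (simp add: tensor_map_proj_apply sum_distrib_left proj_kernel_sym[of n k _ i'] mult_ac)
  qed
  also have "\<dots> = (\<Sum>i\<in>?I. \<Sum>j\<in>?I. f (case_sum i j) * (?y i * ?x j))"
    unfolding tensor_map_proj_W_tensor[OF y]
    by (simp add: kernel_apply_def sum_distrib_left mult_ac)
  also have "\<dots> = (\<Sum>i\<in>?I. \<Sum>j\<in>?I. f (case_sum i j) * (\<Prod>s\<in>vertices k. u s (case_sum i j s)))"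
    by (intro sum.cong refl)
      (auto simp: tensor_def prod.Plus dest!: multi_indices_extensional)
  finally show ?thesis by (simp add: sum.cartesian_product)
qed

lemma prod_zero_one:
  assumes "\<And>x. x \<in> A \<Longrightarrow> f x \<in> {0, 1 :: complex}"
  shows "prod f A \<in> {0, 1}"
proof (cases "\<forall>x\<in>A. f x = 1")
  case False
  then have "\<exists>x\<in>A. f x = 0" using assms by blast
  then show ?thesis by (cases "finite A") (auto intro: prod_zero)
qed simp

text \<open>
  Choose distinct basis vectors \<open>v (a s)\<close> for the vertices, and in every block \<open>B\<close> two vertices \<open>r B \<noteq> t B\<close>. The
  test vector of \<open>s \<in> B\<close> is \<open>v (a (r B)) - v (a s)\<close>, except that the one of \<open>r B\<close> itself is
  \<open>v (a (r B)) - v (a (t B))\<close>. Test vectors from different blocks have disjoint supports, so a labelling that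
  is constant on a block meeting two blocks of \<open>d\<close> contributes zero. If all vertices of \<open>B\<close> carry one
  label \<open>x\<close>, then their coordinates at \<open>x\<close> have product \<open>1\<close> for \<open>x = a (r B)\<close>, also
  \<open>(- 1) * (- 1) = 1\<close> for \<open>x = a (t B)\<close> if \<open>B\<close> has just two elements, and zero otherwise. The simpler choice
  of a difference of two basis vectors common to the whole block would fail for blocks of odd size,
  where the two contributions cancel.
\<close>

lemma ex_test_vectors:
  assumes d: "d \<in> diagrams_no_singletons k" and n: "n \<ge> 2 * k"
  obtains u where "\<And>s. s \<in> vertices k \<Longrightarrow> u s \<in> W n"
    and "\<And>d' g. d' \<in> partition_diagrams k \<Longrightarrow> \<not> same_block d' \<subseteq> same_block d \<Longrightarrow>
      diagram_fn d' g * (\<Prod>s\<in>vertices k. u s (g s)) = 0"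
    and "\<And>g. diagram_fn d g * (\<Prod>s\<in>vertices k. u s (g s)) \<in> {0, 1}"
    and "\<exists>g. g ` vertices k \<subseteq> {1..n} \<and> diagram_fn d g * (\<Prod>s\<in>vertices k. u s (g s)) = 1"
proof -
  let ?X = "vertices k"
  have dP: "d \<in> partition_diagrams k" and part: "partition_on ?X d"
    and no1: "\<And>B. B \<in> d \<Longrightarrow> card B \<noteq> 1"
    using d by (auto simp: diagrams_no_singletons_def partition_diagrams_def)
  have "card ?X \<le> card {1..n}" using n by (simp add: card_Plus)
  then obtain a where a: "a ` ?X \<subseteq> {1..n}" and inj: "inj_on a ?X"
    using card_le_inj[of ?X "{1..n}"] by auto
  have "\<exists>p. fst p \<in> B \<and> snd p \<in> B \<and> snd p \<noteq> fst p" if "B \<in> d" for B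
  proof -
    have "B \<noteq> {}" using part that by (auto simp: partition_on_def)
    then obtain x where "x \<in> B" by auto
    moreover have "B \<noteq> {x}" using no1[OF that] by auto
    ultimately obtain y where "y \<in> B" "y \<noteq> x" by auto
    then show ?thesis using \<open>x \<in> B\<close> by (intro exI[of _ "(x, y)"]) auto
  qed
  then obtain p where p: "\<And>B. B \<in> d \<Longrightarrow> fst (p B) \<in> B \<and> snd (p B) \<in> B \<and> snd (p B) \<noteq> fst (p B)"
    by metis
  define r where "r B = fst (p B)" for B
  define t where "t B = snd (p B)" for B
  have rt: "r B \<in> B" "t B \<in> B" "t B \<noteq> r B" if "B \<in> d" for B
    using p[OF that] by (auto simp: r_def t_def)
  have sub: "B \<subseteq> ?X" if "B \<in> d" for B
    using block_subset_vertices[OF dP that] .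
  have "\<forall>s\<in>?X. \<exists>B. B \<in> d \<and> s \<in> B"
    using part by (auto simp: partition_on_def)
  then obtain b where b: "\<And>s. s \<in> ?X \<Longrightarrow> b s \<in> d \<and> s \<in> b s" by metis
  have b_eq: "b s = B" if "B \<in> d" "s \<in> B" for B s
    using block_unique[OF dP _ that(1) _ that(2)] b[of s] sub[OF that(1)] that(2) by blast
  define q where "q s = (if s = r (b s) then t (b s) else s)" for s
  have q: "q s \<in> b s" "q s \<noteq> r (b s)" if "s \<in> ?X" for s
    using b[OF that] rt[of "b s"] by (auto simp: q_def)
  have rX: "r (b s) \<in> ?X" "q s \<in> ?X" if "s \<in> ?X" for s
    using b[OF that] q[OF that] rt[of "b s"] sub[of "b s"] by auto
  define u where "u s = v (a (r (b s))) - v (a (q s))" for s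
  have u_block: "u s x = (if x = a (r B) then 1 else 0) - (if x = a (if s = r B then t B else s) then 1 else 0)"
    if "B \<in> d" "s \<in> B" for B s x
    unfolding u_def q_def v_def b_eq[OF that] by simp
  have supp: "\<exists>z\<in>b s. x = a z" if "s \<in> ?X" "u s x \<noteq> 0" for s x
    using that b[of s] q(1)[of s] rt[of "b s"] by (auto simp: u_def v_def split: if_splits)
  have inner: "(\<Prod>s\<in>B. u s x) \<in> {0, 1}" if B: "B \<in> d" for B x
  proof -
    have finB: "finite B" using sub[OF B] by (rule finite_subset) simp
    have injB: "a y = a z \<longleftrightarrow> y = z" if "y \<in> B" "z \<in> B" for y z
      using inj sub[OF B] that by (auto simp: inj_on_def)
    consider "x = a (r B)" | "x = a (t B)" "B = {r B, t B}"
      | s where "x = a (t B)" "s \<in> B" "s \<noteq> r B" "s \<noteq> t B" | "x \<noteq> a (r B)" "x \<noteq> a (t B)"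
      using rt[OF B] by blast
    then show ?thesis
    proof cases
      case 1
      then have "u s x = 1" if "s \<in> B" for s
        using that rt[OF B] by (auto simp: u_block[OF B] injB)
      then show ?thesis by simp
    next
      case 2
      have "(\<Prod>s\<in>{r B, t B}. u s x) = 1"
        using 2(1) rt[OF B] by (simp add: u_block[OF B] injB)
      then show ?thesis using 2(2) by simp
    next
      case 3
      then have "u s x = 0"
        using rt[OF B] by (simp add: u_block[OF B] injB)
      then show ?thesis using 3 finB by (auto intro: prod_zero)
    next
      case 4
      then have "u (r B) x = 0"
        using rt[OF B] by (simp add: u_block[OF B])
      then show ?thesis using rt[OF B] finB by (auto intro: prod_zero)
    qed
  qed
  show thesis
  proof (rule that[of u])
    fix s assume s: "s \<in> ?X"
    show "u s \<in> W n"
      unfolding u_def using rX[OF s] a by (intro v_diff_in_W) (simp_all only: image_subset_iff)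
  next
    fix d' g assume d': "d' \<in> partition_diagrams k" and "\<not> same_block d' \<subseteq> same_block d"
    then obtain s s' where "(s, s') \<in> same_block d'" and ns: "(s, s') \<notin> same_block d"
      by (meson subrelI)
    then obtain B' where B': "B' \<in> d'" "s \<in> B'" "s' \<in> B'"
      unfolding same_block_def by blast
    have sX: "s \<in> ?X" "s' \<in> ?X"
      by (rule subsetD[OF block_subset_vertices[OF d' B'(1)]], rule B')+
    have "u s (g s) = 0 \<or> u s' (g s') = 0" if "g s = g s'"
    proof (rule ccontr)
      assume "\<not> (u s (g s) = 0 \<or> u s' (g s') = 0)"
      then have nz: "u s (g s) \<noteq> 0" "u s' (g s') \<noteq> 0" by auto
      obtain z where z: "z \<in> b s" "g s = a z" using supp[OF sX(1) nz(1)] by auto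
      obtain z' where z': "z' \<in> b s'" "g s' = a z'" using supp[OF sX(2) nz(2)] by auto
      have bd: "b s \<in> d" "b s' \<in> d" using b sX by auto
      have "z \<in> ?X" "z' \<in> ?X" using z z' sub[OF bd(1)] sub[OF bd(2)] by auto
      then have "z = z'"
        using that inj z z' by (simp add: inj_on_def)
      then have "b s = b s'"
        using block_unique[OF dP bd z(1)] z'(1) by simp
      then show False using ns b sX by (auto simp: same_block_def)
    qed
    then have "(\<Prod>s\<in>?X. u s (g s)) = 0" if "g s = g s'"
      using that sX by (intro prod_zero) (simp, blast)
    then show "diagram_fn d' g * (\<Prod>s\<in>?X. u s (g s)) = 0"
      using B' by (cases "g s = g s'") (auto simp: diagram_fn_def)
  next
    fix g
    show "diagram_fn d g * (\<Prod>s\<in>?X. u s (g s)) \<in> {0, 1}"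
    proof (cases "\<forall>B\<in>d. \<forall>s\<in>B. \<forall>t\<in>B. g s = g t")
      case True
      have fin: "\<forall>B\<in>d. finite B" using sub finite_subset[of _ ?X] by auto
      have "(\<Prod>s\<in>?X. u s (g s)) = (\<Prod>s\<in>\<Union>d. u s (g s))"
        using part by (simp add: partition_on_def)
      also have "\<dots> = (\<Prod>B\<in>d. \<Prod>s\<in>B. u s (g s))"
        using part fin by (subst prod.Union_disjoint) (auto simp: partition_on_def disjoint_def)
      also have "\<dots> = (\<Prod>B\<in>d. \<Prod>s\<in>B. u s (g (r B)))"
        using True rt by (intro prod.cong refl arg_cong[where f = "u _"]) blast
      also have "\<dots> \<in> {0, 1}"
        using inner by (rule prod_zero_one)
      finally have "(\<Prod>s\<in>?X. u s (g s)) \<in> {0, 1}" .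
      moreover have "diagram_fn d g = 1"
        unfolding diagram_fn_def of_bool_def using True by (rule if_P)
      ultimately show ?thesis by simp
    qed (simp add: diagram_fn_def)
  next
    let ?g = "\<lambda>s. a (r (b s))"
    have "u s (?g s) = 1" if "s \<in> ?X" for s
      using inj_onD[OF inj _ rX[OF that]] q(2)[OF that] by (auto simp: u_def v_def)
    then have "(\<Prod>s\<in>?X. u s (?g s)) = 1" by simp
    moreover have "?g ` ?X \<subseteq> {1..n}"
      unfolding image_subset_iff using rX a by (meson image_subset_iff)
    moreover have "diagram_fn d ?g = 1"
      using b_eq by (simp add: diagram_fn_def)
    ultimately show "\<exists>g. g ` ?X \<subseteq> {1..n} \<and> diagram_fn d g * (\<Prod>s\<in>?X. u s (g s)) = 1"
      by (intro exI[of _ ?g] conjI) (simp_all only: mult_1)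
  qed
qed

text \<open>
  Among the diagrams with nonzero coefficient take one, \<open>e\<close>, that none of the others refines. Pairing
  with its test vectors annihilates all the others, while \<open>e\<close> gives a sum of zeros and at least one \<open>1\<close>.
\<close>

lemma bar_coefficients_zero:
  assumes n: "n \<ge> 2 * k"
    and zero: "(\<Sum>d\<in>diagrams_no_singletons k. op_scale (c d) (bar n k d)) = 0"
    and "d \<in> diagrams_no_singletons k"
  shows "c d = 0"
proof (rule ccontr)
  let ?D = "diagrams_no_singletons k" and ?I = "multi_indices n k"
  have DP: "?D \<subseteq> partition_diagrams k" by (auto simp: diagrams_no_singletons_def)
  have finD: "finite ?D" using DP finite_partition_diagrams by (rule finite_subset)
  assume "c d \<noteq> 0"
  define S where "S = {d \<in> ?D. c d \<noteq> 0}"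
  have "finite (same_block ` S)" "same_block ` S \<noteq> {}"
    using finD assms(3) \<open>c d \<noteq> 0\<close> by (auto simp: S_def)
  then obtain R where R: "R \<in> same_block ` S"
    and R_min: "\<forall>R'\<in>same_block ` S. R' \<subseteq> R \<longrightarrow> R = R'"
    by (rule finite_has_minimal[THEN bexE])
  then obtain e where e: "e \<in> S" and "R = same_block e" by (elim imageE)
  then have min: "same_block e = same_block d'"
    if "d' \<in> S" "same_block d' \<subseteq> same_block e" for d'
    using R_min that by simp
  have eD: "e \<in> ?D" using e by (simp add: S_def)
  obtain u where uW: "\<And>s. s \<in> vertices k \<Longrightarrow> u s \<in> W n"
    and off: "\<And>d' g. d' \<in> partition_diagrams k \<Longrightarrow> \<not> same_block d' \<subseteq> same_block e \<Longrightarrow>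
      diagram_fn d' g * (\<Prod>s\<in>vertices k. u s (g s)) = 0"
    and val: "\<And>g. diagram_fn e g * (\<Prod>s\<in>vertices k. u s (g s)) \<in> {0, 1}"
    and ex: "\<exists>g. g ` vertices k \<subseteq> {1..n} \<and> diagram_fn e g * (\<Prod>s\<in>vertices k. u s (g s)) = 1"
  proof (rule ex_test_vectors[OF eD n], goal_cases)
    case (1 u)
    show ?case by (rule 1(1)[of u]) (fact 1(2-5))+
  qed
  let ?y = "tensor k (\<lambda>s. u (Inl s))" and ?x = "tensor k (\<lambda>s. u (Inr s))"
  define \<phi> where "\<phi> F = (\<Sum>i\<in>?I. ?y i * F ?x i)" for F :: "ctensor \<Rightarrow> ctensor"
  define wt where "wt d p = diagram_fn d (case_sum (fst p) (snd p)) *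
      (\<Prod>s\<in>vertices k. u s (case_sum (fst p) (snd p) s))" for d and p :: "(nat \<Rightarrow> nat) \<times> (nat \<Rightarrow> nat)"
  have phi_bar: "\<phi> (bar n k d) = (\<Sum>p\<in>?I \<times> ?I. wt d p)" for d
    unfolding \<phi>_def bar_eq_kernel_op wt_def
    using kernel_op_pairing[of k u n "diagram_fn d"] uW by (simp add: case_prod_unfold)
  have "0 = \<phi> (\<Sum>d\<in>?D. op_scale (c d) (bar n k d))"
    using zero by (simp add: \<phi>_def)
  also have "\<dots> = (\<Sum>d\<in>?D. c d * \<phi> (bar n k d))"
    unfolding \<phi>_def sum_apply sum_distrib_left op_scale_def fun_scale_def
    by (subst sum.swap) (simp add: mult_ac)
  also have "\<dots> = (\<Sum>d\<in>{e}. c d * \<phi> (bar n k d))"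
  proof (rule sum.mono_neutral_right[OF finD])
    show "\<forall>d\<in>?D - {e}. c d * \<phi> (bar n k d) = 0"
    proof
      fix d assume d: "d \<in> ?D - {e}"
      show "c d * \<phi> (bar n k d) = 0"
      proof (cases "c d = 0")
        case False
        then have "d \<in> S" using d by (simp add: S_def)
        moreover have "same_block e \<noteq> same_block d"
          using d eD DP same_block_inject[of e k d] by auto
        ultimately have "\<not> same_block d \<subseteq> same_block e"
          using min by blast
        moreover have "d \<in> partition_diagrams k" using d DP by auto
        ultimately have "wt d p = 0" for p unfolding wt_def by (intro off)
        then show ?thesis by (simp add: phi_bar)
      qed simp
    qed
  qed (use eD in auto)
  finally have "\<phi> (bar n k e) = 0" using e by (simp add: S_def)
  obtain g where g: "g ` vertices k \<subseteq> {1..n}" "diagram_fn e g * (\<Prod>s\<in>vertices k. u s (g s)) = 1"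
    using ex by blast
  define p where "p = (\<lambda>s\<in>{1..k}. g (Inl s), \<lambda>s\<in>{1..k}. g (Inr s))"
  have pI: "p \<in> ?I \<times> ?I"
    using g(1) by (auto simp: p_def multi_indices_def simp del: One_nat_def atLeastAtMost_iff)
  have lab: "case_sum (fst p) (snd p) s = g s" if "s \<in> vertices k" for s
    using that by (auto simp: p_def)
  have "label_rel k (case_sum (fst p) (snd p)) = label_rel k g"
    unfolding label_rel_def by (rule Collect_cong) (simp only: lab split: prod.split cong: conj_cong)
  then have "diagram_fn e (case_sum (fst p) (snd p)) = diagram_fn e g"
    using eD DP diagram_fn_eq by (metis subsetD)
  then have "wt e p = 1" using g(2) lab by (simp add: wt_def)
  have nonneg: "0 \<le> Re (wt e p')" for p'
  proof -
    have "wt e p' \<in> {0, 1}" unfolding wt_def by (rule val)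
    then show ?thesis by auto
  qed
  have "Re (wt e p) \<le> (\<Sum>p'\<in>?I \<times> ?I. Re (wt e p'))"
    using pI nonneg by (intro member_le_sum) auto
  then show False
    using \<open>wt e p = 1\<close> \<open>\<phi> (bar n k e) = 0\<close> by (simp add: phi_bar flip: Re_sum)
qed

theorem theorem2p5:
  fixes k n :: nat
  assumes "k \<ge> 1" and "n \<ge> 2 * k"
  shows "inj_on (bar n k) (diagrams_no_singletons k) \<and>
    op_vs.independent (bar n k ` diagrams_no_singletons k) \<and>
    op_vs.span (bar n k ` diagrams_no_singletons k) = quasi_partition_algebra n k"
proof (intro conjI)
  let ?D = "diagrams_no_singletons k"
  have DP: "?D \<subseteq> partition_diagrams k" by (auto simp: diagrams_no_singletons_def)
  have finD: "finite ?D" using DP finite_partition_diagrams by (rule finite_subset)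
  show inj: "inj_on (bar n k) ?D"
  proof (rule inj_onI, rule ccontr)
    fix d d' assume d: "d \<in> ?D" "d' \<in> ?D" and eq: "bar n k d = bar n k d'" and ne: "d \<noteq> d'"
    define c :: "diagram \<Rightarrow> complex" where "c = (\<lambda>e. if e = d then 1 else if e = d' then - 1 else 0)"
    have "(\<Sum>e\<in>?D. op_scale (c e) (bar n k e)) = (\<Sum>e\<in>{d, d'}. op_scale (c e) (bar n k e))"
      using finD d by (intro sum.mono_neutral_right) (auto simp: c_def)
    also have "\<dots> = 0" using ne eq by (simp add: c_def)
    finally have "c d = 0" using assms(2) d(1) by (intro bar_coefficients_zero)
    then show False by (simp add: c_def)
  qed
  show "op_vs.independent (bar n k ` ?D)"
  proof
    assume "op_vs.dependent (bar n k ` ?D)"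
    then obtain c where c: "\<exists>F\<in>bar n k ` ?D. c F \<noteq> 0" "(\<Sum>F\<in>bar n k ` ?D. op_scale (c F) F) = 0"
      using finD by (auto simp: op_vs.dependent_finite)
    then have "(\<Sum>d\<in>?D. op_scale (c (bar n k d)) (bar n k d)) = 0"
      by (simp add: sum.reindex[OF inj])
    then have "\<forall>d\<in>?D. c (bar n k d) = 0"
      using bar_coefficients_zero[OF assms(2), of "\<lambda>d. c (bar n k d)"] by blast
    then show False using c(1) by blast
  qed
  show "op_vs.span (bar n k ` ?D) = quasi_partition_algebra n k"
  proof
    show "op_vs.span (bar n k ` ?D) \<subseteq> quasi_partition_algebra n k"
      using DP bar_in_quasi_partition_algebra
      by (intro op_vs.span_minimal subspace_quasi_partition_algebra) auto
    have "bar n k ` partition_diagrams k \<subseteq> op_vs.span (bar n k ` ?D)"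
    proof clarify
      fix d assume "d \<in> partition_diagrams k"
      then show "bar n k d \<in> op_vs.span (bar n k ` ?D)"
        by (cases "d \<in> ?D") (auto simp: bar_isolated op_vs.span_zero intro: op_vs.span_base)
    qed
    then have "op_vs.span (bar n k ` partition_diagrams k) \<subseteq> op_vs.span (bar n k ` ?D)"
      by (intro op_vs.span_minimal op_vs.subspace_span)
    then show "quasi_partition_algebra n k \<subseteq> op_vs.span (bar n k ` ?D)"
      using span_bar_partition_diagrams by blast
  qed
qed

end
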